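(* Let $q\ge1$ be an integer and $p>2q-1$ real. For all $u\in U_q$ and $\lambda>0$, the mapping $$T_{u,\lambda}:\Pi_q\times\mathbb{R}\to\Pi_q\times\mathbb{R},\qquad T_{u,\lambda}(r,a):=(\lambda uru^*,\lambda^2a)$$ is a hypergroup automorphism of $(\Pi_q\times\mathbb{R},*_{p,q})$.
   Context: $\Pi_q$ is the cone of Hermitian positive semidefinite complex $q\times q$ matrices, $U_q$ the unitary group. For $p>2q-1$, $(\Pi_q\times\mathbb{R},*_{p,q})$ is the hypergroup with identity $(0,0)$, involution $\overline{(r,a)}=(r,-a)$ and convolution of point measures $$(\delta_{(r,a)}*_{p,q}\delta_{(s,b)})(f)=\kappa_{p,q}\int_{B_q} f\Bigl(\sqrt{r^2+s^2+rws+(rws)^*},\,a+b-\operatorname{Im}\operatorname{tr}(rws)\Bigr)\Delta(I_q-w^*w)^{p-2q}\,dw,$$ $f\in C_b(\Pi_q\times\mathbb{R})$, where $B_q$ is the set of complex $q\times q$ matrices $w$ with $I_q-w^*w$ positive definite, $\Delta$ is the determinant, $dw$ Lebesgue measure and $\kappa_{p,q}^{-1}=\int_{B_q}\Delta(I_q-w^*w)^{p-2q}dw$. A homeomorphism $T$ of $\Pi_q\times\mathbb{R}$ is a hypergroup automorphism if for all $(r,a),(s,b)\in\Pi_q\times\mathbb{R}$: $T(\delta_{(r,a)}*_{p,q}\delta_{\overline{(s,b)}})=\delta_{T(r,a)}*_{p,q}\delta_{\overline{T(s,b)}}$, where the left side is the image measure under $T$. *)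

theory Defs
  imports "HOL-Analysis.Analysis"
begin

text \<open>Throughout, $q$ is the cardinality of the finite index type \<open>'q\<close>.\<close>

definition ctranspose :: "complex^'q^'q \<Rightarrow> complex^'q^'q" where
  "ctranspose A = (\<chi> i j. cnj (A $ j $ i))"

definition hermitian :: "complex^'q^'q \<Rightarrow> bool" where
  "hermitian A \<longleftrightarrow> ctranspose A = A"

definition cinner_vec :: "complex^'q \<Rightarrow> complex^'q \<Rightarrow> complex" where
  "cinner_vec x y = (\<Sum>i\<in>UNIV. cnj (x $ i) * y $ i)"

text \<open>For Hermitian \<open>A\<close> the value \<open>cinner_vec x (A *v x)\<close> is real, so taking real parts
  in the next two definitions loses nothing.\<close>

definition pos_semidef :: "complex^'q::finite^'q \<Rightarrow> bool" where
  "pos_semidef A \<longleftrightarrow> hermitian A \<and> (\<forall>x. 0 \<le> Re (cinner_vec x (A *v x)))"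

definition pos_def :: "complex^'q::finite^'q \<Rightarrow> bool" where
  "pos_def A \<longleftrightarrow> hermitian A \<and> (\<forall>x. x \<noteq> 0 \<longrightarrow> 0 < Re (cinner_vec x (A *v x)))"

definition psd_cone :: "(complex^'q::finite^'q) set" where
  "psd_cone = {A. pos_semidef A}"

definition psd_sqrt :: "complex^'q::finite^'q \<Rightarrow> complex^'q^'q" where
  "psd_sqrt A = (THE B. B \<in> psd_cone \<and> B ** B = A)"

definition unitary_group :: "(complex^'q::finite^'q) set" where
  "unitary_group = {u. ctranspose u ** u = mat 1 \<and> u ** ctranspose u = mat 1}"

definition matrix_ball :: "(complex^'q::finite^'q) set" where
  "matrix_ball = {w. pos_def (mat 1 - ctranspose w ** w)}"

text \<open>The determinant of a Hermitian matrix is real, and positive for \<open>w \<in> matrix_ball\<close>.\<close>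

definition ball_weight :: "real \<Rightarrow> complex^'q::finite^'q \<Rightarrow> real" where
  "ball_weight p w = Re (det (mat 1 - ctranspose w ** w)) powr (p - 2 * real CARD('q))"

definition kappa :: "'q::finite itself \<Rightarrow> real \<Rightarrow> real" where
  "kappa _ p = inverse (LINT w:(matrix_ball :: (complex^'q^'q) set)|lborel. ball_weight p w)"

definition hg_space :: "((complex^'q::finite^'q) \<times> real) set" where
  "hg_space = psd_cone \<times> UNIV"

definition hg_involution ::
  "(complex^'q::finite^'q) \<times> real \<Rightarrow> (complex^'q^'q) \<times> real" where
  "hg_involution = (\<lambda>(r, a). (r, - a))"

fun conv_point ::
  "(complex^'q::finite^'q) \<times> real \<Rightarrow> (complex^'q^'q) \<times> real \<Rightarrow> complex^'q^'q
    \<Rightarrow> (complex^'q^'q) \<times> real" where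
  "conv_point (r, a) (s, b) w =
     (psd_sqrt (r ** r + s ** s + r ** w ** s + ctranspose (r ** w ** s)),
      a + b - Im (trace (r ** w ** s)))"

definition conv_functional ::
  "real \<Rightarrow> (complex^'q::finite^'q) \<times> real \<Rightarrow> (complex^'q^'q) \<times> real
    \<Rightarrow> ((complex^'q^'q) \<times> real \<Rightarrow> complex) \<Rightarrow> complex" where
  "conv_functional p x y f =
     kappa TYPE('q) p *\<^sub>R
       (LINT w:matrix_ball|lborel. ball_weight p w *\<^sub>R f (conv_point x y w))"

text \<open>Convolution of the point measures at \<open>x\<close> and \<open>y\<close>: the unique finite Borel measure on
  \<open>hg_space\<close> whose integrals of bounded continuous functions are given by the functional above.\<close>

definition point_conv ::
  "real \<Rightarrow> (complex^'q::finite^'q) \<times> real \<Rightarrow> (complex^'q^'q) \<times> real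
    \<Rightarrow> ((complex^'q^'q) \<times> real) measure" where
  "point_conv p x y =
     (THE M. sets M = sets (restrict_space borel hg_space) \<and> finite_measure M \<and>
        (\<forall>f :: (complex^'q^'q) \<times> real \<Rightarrow> complex.
           continuous_on hg_space f \<and> bounded (f ` hg_space) \<longrightarrow>
           integral\<^sup>L M f = conv_functional p x y f))"

text \<open>A homeomorphism of \<open>X\<close> compatible with the convolution \<open>conv\<close> of point measures and the
  involution \<open>inv'\<close>; \<open>distr\<close> forms the image measure.\<close>

definition hypergroup_automorphism ::
  "'a::topological_space set \<Rightarrow> ('a \<Rightarrow> 'a \<Rightarrow> 'a measure) \<Rightarrow> ('a \<Rightarrow> 'a) \<Rightarrow> ('a \<Rightarrow> 'a) \<Rightarrow> bool" where
  "hypergroup_automorphism X conv inv' T \<longleftrightarrow>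
     (\<exists>T'. homeomorphism X X T T') \<and>
     (\<forall>x\<in>X. \<forall>y\<in>X. distr (conv x (inv' y)) (restrict_space borel X) T = conv (T x) (inv' (T y)))"

definition T_map ::
  "complex^'q::finite^'q \<Rightarrow> real \<Rightarrow> (complex^'q^'q) \<times> real \<Rightarrow> (complex^'q^'q) \<times> real" where
  "T_map u l = (\<lambda>(r, a). (l *\<^sub>R (u ** r ** ctranspose u), l\<^sup>2 * a))"

end

theory Submission
  imports Defs
begin

text \<open>
  The heart of the matter is a substitution. In the convolution integral at \<open>T(r,a)\<close> and \<open>T(s,b)\<close>,
  where \<open>T = T_map u l\<close>, replace \<open>w\<close> by \<open>u w u\<^sup>*\<close>. Because \<open>u\<close> is unitary, all products \<open>r r\<close>, \<open>s s\<close>,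
  \<open>r w s\<close> get conjugated by \<open>u\<close> and scaled by \<open>l\<^sup>2\<close>, the trace gets scaled by \<open>l\<^sup>2\<close>, and the square root
  of a conjugated and scaled matrix is the conjugated root scaled by \<open>l\<close>. So the point at which the
  test function is evaluated is exactly the \<open>T\<close>-image of the old one (\<open>conv_point_T_map\<close>). The
  substitution is an orthogonal transformation of the space of matrices, hence preserves Lebesgue
  measure, and it preserves the ball and the determinant weight. Therefore the convolution functional
  at the images, applied to \<open>f\<close>, is the original one applied to \<open>f \<circ> T\<close> (\<open>conv_functional_T_map\<close>).

  The convolution of point measures is the measure that represents this functional. To pass
  from functionals to measures one needs that such a measure exists and is unique. Uniqueness holds
  because finite Borel measures on a metric space are determined by the integrals of bounded
  continuous functions (\<open>finite_measure_eqI_bounded_continuous\<close>). For existence, the weighted Lebesgue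
  measure on the ball is pushed forward along \<open>conv_point x y\<close> (\<open>is_point_conv_exists\<close>); this requires
  the positive semidefinite square root to exist, to be unique, and to depend continuously on its
  argument, which is shown by topological means: squaring is injective (\<open>psd_square_inj\<close>), it is onto
  by invariance of domain and connectedness (\<open>pos_def_sqrt_exists\<close>), and its inverse has a closed,
  locally bounded graph (\<open>continuous_on_psd_sqrt\<close>). The invariance of Lebesgue measure under orthogonal
  maps of an arbitrary Euclidean space comes from Vitali's covering theorem (\<open>lborel_distr_orthogonal\<close>).
\<close>

section \<open>Matrix algebra and the real inner product\<close>

lemma matrix_linear_left: "linear (\<lambda>B :: complex^'q::finite^'q. A ** B)"
  by (rule linearI) (simp_all add: vec_eq_iff matrix_matrix_mult_def ring_distribs sum.distrib
      scaleR_sum_right)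

lemma matrix_linear_right: "linear (\<lambda>B :: complex^'q::finite^'q. B ** A)"
  by (rule linearI) (simp_all add: vec_eq_iff matrix_matrix_mult_def ring_distribs sum.distrib
      scaleR_sum_right)

lemmas matrix_ring_simps =
  linear_add[OF matrix_linear_left] linear_diff[OF matrix_linear_left]
  linear_scale[OF matrix_linear_left]
  linear_add[OF matrix_linear_right] linear_diff[OF matrix_linear_right]
  linear_scale[OF matrix_linear_right]

lemma ctranspose_linear: "linear (ctranspose :: complex^'q::finite^'q \<Rightarrow> _)"
  by (rule linearI) (simp_all add: ctranspose_def vec_eq_iff)

lemmas ctranspose_simps =
  linear_add[OF ctranspose_linear] linear_diff[OF ctranspose_linear]
  linear_scale[OF ctranspose_linear] linear_0[OF ctranspose_linear]

lemma ctranspose_ctranspose [simp]: "ctranspose (ctranspose A) = A"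
  by (simp add: ctranspose_def vec_eq_iff)

lemma ctranspose_mult: "ctranspose (A ** B) = ctranspose B ** ctranspose (A :: complex^'q::finite^'q)"
  by (simp add: ctranspose_def vec_eq_iff matrix_matrix_mult_def mult.commute)

lemma ctranspose_one [simp]: "ctranspose (mat 1 :: complex^'q::finite^'q) = mat 1"
  by (simp add: ctranspose_def vec_eq_iff mat_def)

text \<open>The real inner product of \<open>complex^'q\<close> is the real part of the Hermitian one. Since the
  definitions of positivity only see real parts, everything below works with \<open>\<bullet>\<close>: conjugate
  transposition is its adjoint, both on vectors and, through the Frobenius product, on matrices.\<close>

lemma cinner_vec_inner: "Re (cinner_vec x y) = x \<bullet> y"
  by (simp add: cinner_vec_def inner_vec_def inner_complex_def)

lemma inner_mult_vec_adjoint: "(A *v x) \<bullet> y = x \<bullet> (ctranspose A *v (y :: complex^'q::finite))"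
proof -
  have "cinner_vec (A *v x) y = cinner_vec x (ctranspose A *v y)"
    unfolding cinner_vec_def ctranspose_def matrix_vector_mult_def
    by (simp add: sum_distrib_left sum_distrib_right mult_ac) (rule sum.swap)
  then show ?thesis by (metis cinner_vec_inner)
qed

text \<open>The Frobenius product splits over columns, and left multiplication acts column by column; this
  carries statements about vectors over to matrices.\<close>

lemma inner_matrix_columns:
  "A \<bullet> B = (\<Sum>j\<in>UNIV. column j A \<bullet> column j (B :: complex^'q::finite^'q))"
  unfolding inner_vec_def column_def by (simp, rule sum.swap)

lemma column_mult: "column j (A ** B) = A *v column j (B :: complex^'q::finite^'q)"
  by (simp add: column_def vec_eq_iff matrix_matrix_mult_def matrix_vector_mult_def)

lemma inner_mult_left_adjoint:
  "(A ** B) \<bullet> C = B \<bullet> (ctranspose A ** (C :: complex^'q::finite^'q))"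
  by (simp add: inner_matrix_columns column_mult inner_mult_vec_adjoint)

lemma inner_ctranspose: "ctranspose A \<bullet> ctranspose B = A \<bullet> (B :: complex^'q::finite^'q)"
  unfolding inner_vec_def ctranspose_def by (simp add: inner_complex_def, rule sum.swap)

lemma inner_mult_right_adjoint:
  fixes A B C :: "complex^'q::finite^'q"
  shows "(B ** A) \<bullet> C = B \<bullet> (C ** ctranspose A)"
  using inner_mult_left_adjoint[of "ctranspose A" "ctranspose B" "ctranspose C"]
    inner_ctranspose[of "B ** A" C] inner_ctranspose[of B "C ** ctranspose A"]
  by (simp add: ctranspose_mult)

lemma pos_semidef_iff:
  "pos_semidef A \<longleftrightarrow> ctranspose A = A \<and> (\<forall>x. 0 \<le> x \<bullet> (A *v x))"
  by (simp add: pos_semidef_def hermitian_def cinner_vec_inner)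

lemma pos_def_iff:
  "pos_def A \<longleftrightarrow> ctranspose A = A \<and> (\<forall>x. x \<noteq> 0 \<longrightarrow> 0 < x \<bullet> (A *v x))"
  by (simp add: pos_def_def hermitian_def cinner_vec_inner)

lemma pos_def_imp_pos_semidef: "pos_def A \<Longrightarrow> pos_semidef A"
  unfolding pos_def_iff pos_semidef_iff
  by (intro conjI allI, blast, case_tac "x = 0") auto

lemma psd_inner_mult_nonneg:
  fixes B D :: "complex^'q::finite^'q"
  assumes "pos_semidef B" shows "0 \<le> D \<bullet> (B ** D)"
  using assms by (auto simp: inner_matrix_columns column_mult pos_semidef_iff intro: sum_nonneg)

section \<open>The positive semidefinite square root\<close>

text \<open>A positive semidefinite quadratic form is nonnegative along the line \<open>x + t *\<^sub>R f x\<close>. If it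
  vanishes at \<open>x\<close>, the linear term \<open>2 * t * (norm (f x))\<^sup>2\<close> dominates for small negative \<open>t\<close>.\<close>

lemma positive_form_kernel:
  fixes f :: "'a::real_inner \<Rightarrow> 'a"
  assumes lin: "linear f" and sym: "\<And>x y. f x \<bullet> y = x \<bullet> f y"
    and pos: "\<And>x. 0 \<le> x \<bullet> f x" and 0: "x \<bullet> f x = 0"
  shows "f x = 0"
proof -
  define y where "y = f x"
  have q: "0 \<le> t * (2 * (y \<bullet> y) + t * (y \<bullet> f y))" for t
  proof -
    have "(x + t *\<^sub>R y) \<bullet> f (x + t *\<^sub>R y) = t * (2 * (y \<bullet> y) + t * (y \<bullet> f y))"
      using 0 sym[of x y]
      by (simp add: linear_add[OF lin] linear_scale[OF lin] inner_simps y_def algebra_simps)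
    with pos[of "x + t *\<^sub>R y"] show ?thesis by simp
  qed
  \<comment> \<open>Small enough that the quadratic term is at most half of the linear one.\<close>
  define t where "t = - (y \<bullet> y) / (1 + y \<bullet> f y)"
  have d: "0 < 1 + y \<bullet> f y" using pos[of y] by simp
  have "\<bar>t * (y \<bullet> f y)\<bar> \<le> y \<bullet> y"
    unfolding t_def using pos[of y] d
    by (simp add: abs_mult field_simps)
  then have "y \<bullet> y \<le> 2 * (y \<bullet> y) + t * (y \<bullet> f y)" by linarith
  moreover have "t < 0" if "y \<noteq> 0"
    unfolding t_def using d that by (simp add: divide_neg_pos)
  ultimately have "y = 0"
    using q[of t] by (metis inner_gt_zero_iff mult_neg_pos not_le order_less_le_trans)
  then show ?thesis by (simp add: y_def)
qed

lemma psd_inner_mult_eq_0: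
  fixes B D :: "complex^'q::finite^'q"
  assumes B: "pos_semidef B" and "D \<bullet> (B ** D) = 0"
  shows "B ** D = 0"
proof (rule positive_form_kernel[OF matrix_linear_left])
  show "(B ** x) \<bullet> y = x \<bullet> (B ** y)" for x y :: "complex^'q^'q"
    using B by (simp add: inner_mult_left_adjoint pos_semidef_iff)
qed (use assms psd_inner_mult_nonneg in auto)

text \<open>Put \<open>D = B - C\<close>. From \<open>B\<^sup>2 = C\<^sup>2\<close> follows \<open>B D = - D C\<close>, so the traces of the positive semidefinite
  matrices \<open>D B D\<close> and \<open>D C D\<close> add up to zero. Hence both vanish, which forces \<open>B D = C D = 0\<close> and
  \<open>D\<^sup>2 = 0\<close>.\<close>

lemma psd_square_inj:
  fixes B C :: "complex^'q::finite^'q"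
  assumes B: "pos_semidef B" and C: "pos_semidef C" and eq: "B ** B = C ** C"
  shows "B = C"
proof -
  define D where "D = B - C"
  have cD: "ctranspose D = D"
    using B C by (simp add: D_def ctranspose_simps pos_semidef_iff)
  have "B ** D + D ** C = 0"
    unfolding D_def using eq by (simp add: matrix_ring_simps)
  then have "D \<bullet> (B ** D) + D \<bullet> (D ** C) = 0" by (metis inner_add_right inner_zero_right)
  moreover have "D \<bullet> (D ** C) = D \<bullet> (C ** D)"
    using inner_ctranspose[of D "D ** C"] C by (simp add: ctranspose_mult cD pos_semidef_iff)
  ultimately have "D \<bullet> (B ** D) = 0" "D \<bullet> (C ** D) = 0"
    using psd_inner_mult_nonneg[OF B, of D] psd_inner_mult_nonneg[OF C, of D] by linarith+
  then have "B ** D = 0" "C ** D = 0" using psd_inner_mult_eq_0 B C by blast+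
  then have "D ** D = 0" unfolding D_def by (simp add: matrix_ring_simps)
  then have "D \<bullet> D = 0"
    using inner_mult_left_adjoint[of D "mat 1" D] by (simp add: cD)
  then show ?thesis by (simp add: D_def)
qed

lemma continuous_on_matrix_mult [continuous_intros]:
  fixes f g :: "'a::topological_space \<Rightarrow> complex^'q::finite^'q"
  assumes "continuous_on S f" "continuous_on S g"
  shows "continuous_on S (\<lambda>x. f x ** g x)"
  unfolding matrix_matrix_mult_def by (intro continuous_intros assms)

lemma continuous_on_matrix_vector_mult [continuous_intros]:
  fixes f :: "'a::topological_space \<Rightarrow> complex^'q::finite^'q"
  assumes "continuous_on S f" "continuous_on S g"
  shows "continuous_on S (\<lambda>x. f x *v g x)"
  unfolding matrix_vector_mult_def by (intro continuous_intros assms)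

lemma continuous_on_ctranspose [continuous_intros]:
  fixes f :: "'a::topological_space \<Rightarrow> complex^'q::finite^'q"
  assumes "continuous_on S f"
  shows "continuous_on S (\<lambda>x. ctranspose (f x))"
  unfolding ctranspose_def by (intro continuous_intros assms)

lemma matrix_vector_linear: "linear (\<lambda>A :: complex^'q::finite^'q. A *v x)"
  by (rule linearI) (simp_all add: vec_eq_iff matrix_vector_mult_def ring_distribs sum.distrib
      scaleR_sum_right)

lemma matrix_vector_linear': "linear (\<lambda>x. (A :: complex^'q::finite^'q) *v x)"
  by (rule linearI) (simp_all add: vec_eq_iff matrix_vector_mult_def ring_distribs sum.distrib
      scaleR_sum_right)

lemmas matrix_vector_simps =
  linear_add[OF matrix_vector_linear] linear_diff[OF matrix_vector_linear]
  linear_scale[OF matrix_vector_linear] linear_0[OF matrix_vector_linear]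
  linear_add[OF matrix_vector_linear'] linear_diff[OF matrix_vector_linear']
  linear_scale[OF matrix_vector_linear'] linear_0[OF matrix_vector_linear']

lemma closed_psd_cone: "closed (psd_cone :: (complex^'q::finite^'q) set)"
proof -
  have "psd_cone = {A. ctranspose A = A} \<inter> (\<Inter>x. {A :: complex^'q^'q. 0 \<le> x \<bullet> (A *v x)})"
    by (auto simp: psd_cone_def pos_semidef_iff)
  also have "closed \<dots>"
    by (intro closed_Int closed_INT ballI closed_Collect_eq closed_Collect_le continuous_intros)
  finally show ?thesis .
qed

text \<open>Positivity may be tested on the compact unit sphere, so its failure is the projection of a closed
  set along a compact factor.\<close>

lemma open_positive_forms:
  "open {A :: complex^'q::finite^'q. \<forall>x. x \<noteq> 0 \<longrightarrow> 0 < x \<bullet> (A *v x)}"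
proof -
  let ?T = "{z :: (complex^'q) \<times> (complex^'q^'q). fst z \<bullet> (snd z *v fst z) \<le> 0}"
  have "closed ?T" by (intro closed_Collect_le continuous_intros)
  then have "closed {A. \<exists>x. x \<in> sphere 0 1 \<and> (x, A) \<in> ?T}"
    by (rule closed_compact_projection[OF compact_sphere])
  moreover have "{A. \<exists>x. x \<in> sphere 0 1 \<and> (x, A) \<in> ?T} =
      - {A. \<forall>x. x \<noteq> 0 \<longrightarrow> 0 < x \<bullet> (A *v x)}"
  proof -
    have "(\<exists>x. norm x = 1 \<and> x \<bullet> (A *v x) \<le> 0) \<longleftrightarrow> (\<exists>x. x \<noteq> 0 \<and> x \<bullet> (A *v x) \<le> 0)"
      for A :: "complex^'q^'q"
    proof
      assume "\<exists>x. x \<noteq> 0 \<and> x \<bullet> (A *v x) \<le> 0"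
      then obtain x where "x \<noteq> 0" "x \<bullet> (A *v x) \<le> 0" by blast
      then show "\<exists>x. norm x = 1 \<and> x \<bullet> (A *v x) \<le> 0"
        by (intro exI[of _ "sgn x"])
          (auto simp: norm_sgn sgn_div_norm matrix_vector_simps mult_nonneg_nonpos)
    qed (metis norm_zero zero_neq_one)
    then show ?thesis by (auto simp: not_less)
  qed
  ultimately show ?thesis by (simp add: closed_def)
qed

lemma inner_square:
  assumes "ctranspose B = B"
  shows "x \<bullet> ((B ** B) *v x) = (norm (B *v x))\<^sup>2"
  using inner_mult_vec_adjoint[of B x "B *v x"] assms
  by (simp add: matrix_vector_mul_assoc power2_norm_eq_inner)

text \<open>The left-hand side is the trace of \<open>B\<^sup>2\<close>. Thus square roots of bounded families are bounded, which
  is the source of all compactness arguments for square roots below.\<close>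

lemma norm_square_hermitian:
  assumes "ctranspose B = B"
  shows "(norm B)\<^sup>2 \<le> norm (mat 1 :: complex^'q^'q) * norm (B ** B :: complex^'q::finite^'q)"
proof -
  have "(norm B)\<^sup>2 = mat 1 \<bullet> (B ** B)"
    using inner_mult_left_adjoint[of B "mat 1" B] assms by (simp add: power2_norm_eq_inner)
  also have "\<dots> \<le> norm (mat 1 :: complex^'q^'q) * norm (B ** B)" by (rule norm_cauchy_schwarz)
  finally show ?thesis .
qed

text \<open>Square roots of a convergent sequence stay bounded, so some subsequence of them converges; this
  makes the set of squares of positive semidefinite matrices closed.\<close>

lemma psd_square_limit:
  fixes A :: "nat \<Rightarrow> complex^'q::finite^'q"
  assumes lim: "A \<longlonglongrightarrow> L" and B: "\<And>n. pos_semidef (B n)" "\<And>n. B n ** B n = A n"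
  shows "\<exists>C. pos_semidef C \<and> C ** C = L"
proof -
  from lim have "bounded (range A)" by (simp add: convergent_imp_bounded convergentI)
  then obtain K where K: "norm (A n) \<le> K" for n by (auto simp: bounded_iff)
  have "(norm (B n))\<^sup>2 \<le> norm (mat 1 :: complex^'q^'q) * K" for n
    using norm_square_hermitian[of "B n"] B[of n] K[of n]
    by (metis (no_types, lifting) mult_left_mono norm_ge_zero order_trans pos_semidef_iff)
  then have "norm (B n) \<le> sqrt (norm (mat 1 :: complex^'q^'q) * K)" for n
    by (simp add: real_le_rsqrt)
  then have "bounded (range B)" by (auto simp: bounded_iff)
  then obtain C s where s: "strict_mono s" and C: "(B \<circ> s) \<longlonglongrightarrow> C"
    using bounded_imp_convergent_subsequence by blast
  have "C \<in> psd_cone"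
    by (rule closed_sequentially[OF closed_psd_cone _ C]) (simp add: psd_cone_def B)
  moreover have "(\<lambda>n. (B \<circ> s) n ** (B \<circ> s) n) \<longlonglongrightarrow> C ** C"
    by (rule continuous_on_tendsto_compose[of UNIV "\<lambda>X. X ** X", OF _ C])
      (auto intro: continuous_intros)
  then have "(A \<circ> s) \<longlonglongrightarrow> C ** C" by (simp add: B comp_def)
  with LIMSEQ_subseq_LIMSEQ[OF lim s] have "C ** C = L" by (rule LIMSEQ_unique[rotated])
  ultimately show ?thesis by (auto simp: psd_cone_def)
qed

lemma psd_plus_pos_multiple_of_one:
  assumes "pos_semidef A" "e > 0"
  shows "pos_def (A + e *\<^sub>R mat 1 :: complex^'q::finite^'q)"
  using assms
  by (auto simp: pos_def_iff pos_semidef_iff ctranspose_simps matrix_vector_simps inner_add_right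
      intro!: add_nonneg_pos)

lemma pos_def_square:
  assumes "pos_def B" shows "pos_def (B ** B)"
proof -
  have "x \<bullet> ((B ** B) *v x) > 0" if "x \<noteq> 0" for x
  proof -
    have "B *v x \<noteq> 0" using assms that unfolding pos_def_iff by (metis inner_zero_right less_irrefl)
    then show ?thesis using assms by (simp add: inner_square pos_def_iff)
  qed
  then show ?thesis using assms by (simp add: pos_def_iff ctranspose_mult)
qed

text \<open>Squaring is continuous and injective on the positive definite matrices, an open subset of the real
  space of Hermitian matrices, so by invariance of domain its image is open. It is relatively closed
  by compactness and contains the identity, and the positive definite matrices are convex, hence
  connected; so every one of them is a square.\<close>

lemma pos_def_sqrt_exists:
  assumes "pos_def (A :: complex^'q::finite^'q)"
  shows "\<exists>B. pos_def B \<and> B ** B = A"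
proof -
  let ?P = "{A :: complex^'q^'q. pos_def A}" and ?H = "{A :: complex^'q^'q. ctranspose A = A}"
  let ?sq = "\<lambda>B :: complex^'q^'q. B ** B"
  have sub: "subspace ?H" by (simp add: subspace_def ctranspose_simps)
  have P: "?P = ?H \<inter> {A. \<forall>x. x \<noteq> 0 \<longrightarrow> 0 < x \<bullet> (A *v x)}" by (auto simp: pos_def_iff)
  have "openin (top_of_set ?H) ?P" unfolding P using open_positive_forms by blast
  then have "openin (top_of_set ?H) (?sq ` ?P)"
  proof (rule invariance_of_domain_subspaces[OF _ sub sub])
    show "continuous_on ?P ?sq" by (intro continuous_intros)
    show "inj_on ?sq ?P"
      by (auto intro!: inj_onI psd_square_inj pos_def_imp_pos_semidef)
  qed (auto simp: ctranspose_mult pos_def_iff)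
  moreover have im: "?sq ` ?P \<subseteq> ?P" using pos_def_square by auto
  moreover have "?P \<subseteq> ?H" by (auto simp: pos_def_iff)
  ultimately have op: "openin (top_of_set ?P) (?sq ` ?P)"
    by (rule openin_subset_trans)
  have cl: "closedin (top_of_set ?P) (?sq ` ?P)"
    unfolding closedin_limpt
  proof (intro conjI im allI impI)
    fix L assume L: "L islimpt ?sq ` ?P \<and> L \<in> ?P"
    then obtain f where f: "\<And>n. f n \<in> ?sq ` ?P" "f \<longlonglongrightarrow> L"
      unfolding islimpt_sequential by auto
    then have "\<forall>n. \<exists>B. pos_def B \<and> B ** B = f n"
      by (metis (no_types, lifting) imageE mem_Collect_eq)
    then obtain B where B: "\<And>n. pos_def (B n)" "\<And>n. B n ** B n = f n" by metis
    obtain C where C: "pos_semidef C" "C ** C = L"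
      using psd_square_limit[OF f(2), of B] B pos_def_imp_pos_semidef by blast
    \<comment> \<open>The limit of the roots is definite: a null vector of the root would be one of its square.\<close>
    have "0 < x \<bullet> (C *v x)" if "x \<noteq> 0" for x
    proof -
      have "x \<bullet> (C *v x) \<noteq> 0"
      proof
        assume "x \<bullet> (C *v x) = 0"
        with C(1) have "C *v x = 0"
          by (intro positive_form_kernel[OF matrix_vector_linear'])
            (auto simp: inner_mult_vec_adjoint pos_semidef_iff)
        then have "x \<bullet> (L *v x) = 0"
          by (metis C(2) inner_zero_right matrix_vector_mul_assoc matrix_vector_simps(8))
        with L that show False by (metis less_irrefl mem_Collect_eq pos_def_iff)
      qed
      with C show ?thesis by (simp add: pos_semidef_iff order_less_le)
    qed
    with C show "L \<in> ?sq ` ?P" by (auto simp: pos_def_iff pos_semidef_iff)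
  qed
  have "connected ?P"
  proof (rule convex_connected, rule convexI)
    fix A B :: "complex^'q^'q" and u v :: real
    assume h: "A \<in> ?P" "B \<in> ?P" "0 \<le> u" "0 \<le> v" "u + v = 1"
    have "0 < x \<bullet> ((u *\<^sub>R A + v *\<^sub>R B) *v x)" if "x \<noteq> 0" for x
    proof -
      have "0 < x \<bullet> (A *v x)" "0 < x \<bullet> (B *v x)" using h that by (auto simp: pos_def_iff)
      with h show ?thesis
        by (cases "u = 0") (auto simp: matrix_vector_simps inner_add_right intro!: add_pos_nonneg)
    qed
    with h show "u *\<^sub>R A + v *\<^sub>R B \<in> ?P" by (simp add: pos_def_iff ctranspose_simps)
  qed
  moreover have "mat 1 \<in> ?P" by (simp add: pos_def_iff)
  then have "?sq ` ?P \<noteq> {}" by blast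
  ultimately have "?sq ` ?P = ?P"
    using op cl unfolding connected_clopen by blast
  with assms show ?thesis by (metis (no_types, lifting) imageE mem_Collect_eq)
qed

text \<open>Approximate \<open>A\<close> by the positive definite matrices \<open>A + mat 1 / (n + 1)\<close>.\<close>

lemma psd_sqrt_exists:
  assumes "pos_semidef (A :: complex^'q::finite^'q)"
  shows "\<exists>B. pos_semidef B \<and> B ** B = A"
proof -
  define A' where "A' n = A + inverse (real (Suc n)) *\<^sub>R mat 1" for n
  have "\<exists>B. pos_semidef B \<and> B ** B = A' n" for n
    using pos_def_sqrt_exists[OF psd_plus_pos_multiple_of_one[OF assms]] pos_def_imp_pos_semidef
    unfolding A'_def by (metis inverse_positive_iff_positive of_nat_0_less_iff zero_less_Suc)
  then obtain B where B: "\<And>n. pos_semidef (B n)" "\<And>n. B n ** B n = A' n" by metis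
  have "A' \<longlonglongrightarrow> A + 0 *\<^sub>R mat 1"
    unfolding A'_def by (intro tendsto_intros LIMSEQ_inverse_real_of_nat)
  then have "A' \<longlonglongrightarrow> A" by simp
  from psd_square_limit[OF this B] show ?thesis .
qed

lemma psd_sqrt_unique:
  assumes "B \<in> psd_cone" "B ** B = A"
  shows "psd_sqrt A = B"
  unfolding psd_sqrt_def
proof (rule the_equality)
  show "C = B" if "C \<in> psd_cone \<and> C ** C = A" for C
    by (rule psd_square_inj) (use assms that in \<open>simp_all add: psd_cone_def\<close>)
qed (use assms in simp)

lemma psd_sqrt_in_cone_square:
  assumes "A \<in> psd_cone"
  shows "psd_sqrt A \<in> psd_cone" "psd_sqrt A ** psd_sqrt A = A"
proof -
  obtain B where "B \<in> psd_cone" "B ** B = A"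
    using psd_sqrt_exists[of A] assms by (auto simp: psd_cone_def)
  with psd_sqrt_unique[OF this] show "psd_sqrt A \<in> psd_cone" "psd_sqrt A ** psd_sqrt A = A"
    by auto
qed

text \<open>On bounded parts of the cone the square root takes values in a compact ball, and its graph is
  closed because it is cut out by the continuous equation \<open>B ** B = A\<close>.\<close>

lemma continuous_on_psd_sqrt: "continuous_on (psd_cone :: (complex^'q::finite^'q) set) psd_sqrt"
proof -
  have bdd: "continuous_on (psd_cone \<inter> cball 0 R) (psd_sqrt :: complex^'q^'q \<Rightarrow> _)" for R
  proof (rule continuous_from_closed_graph)
    let ?S = "psd_cone \<inter> cball 0 R :: (complex^'q^'q) set"
    let ?K = "sqrt (norm (mat 1 :: complex^'q^'q) * R)"
    show "compact (cball 0 ?K :: (complex^'q^'q) set)" by simp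
    have "norm (psd_sqrt A) \<le> ?K" if "A \<in> ?S" for A
    proof -
      have "(norm (psd_sqrt A))\<^sup>2 \<le> norm (mat 1 :: complex^'q^'q) * norm A"
        using norm_square_hermitian[of "psd_sqrt A"] psd_sqrt_in_cone_square[of A] that
        by (simp add: psd_cone_def pos_semidef_iff)
      also have "\<dots> \<le> norm (mat 1 :: complex^'q^'q) * R"
        using that by (intro mult_left_mono) auto
      finally show ?thesis by (simp add: real_le_rsqrt)
    qed
    then show "psd_sqrt \<in> ?S \<rightarrow> cball 0 ?K" by auto
    have "(\<lambda>A. (A, psd_sqrt A)) ` ?S = {z. snd z ** snd z = fst z} \<inter> (?S \<times> psd_cone)"
      (is "?L = ?R")
    proof
      show "?L \<subseteq> ?R" by (auto simp: psd_sqrt_in_cone_square)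
      show "?R \<subseteq> ?L"
      proof
        fix z assume z: "z \<in> ?R"
        then have "psd_sqrt (fst z) = snd z" by (intro psd_sqrt_unique) auto
        with z show "z \<in> ?L" by (intro image_eqI[of _ _ "fst z"]) auto
      qed
    qed
    also have "closed \<dots>"
      by (intro closed_Int closed_Times closed_Collect_eq continuous_intros closed_psd_cone
          closed_cball)
    finally show "closed ((\<lambda>A. (A, psd_sqrt A)) ` ?S)" .
  qed
  show ?thesis
    unfolding continuous_on_eq_continuous_within
  proof
    fix A :: "complex^'q^'q" assume A: "A \<in> psd_cone"
    have "continuous (at A within psd_cone \<inter> cball 0 (norm A + 1)) psd_sqrt"
      using bdd[of "norm A + 1"] A by (simp add: continuous_on_eq_continuous_within)
    moreover have "at A within psd_cone \<inter> cball 0 (norm A + 1) = at A within psd_cone"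
      by (rule at_within_nhd[of _ "ball 0 (norm A + 1)"]) auto
    ultimately show "continuous (at A within psd_cone) psd_sqrt" by simp
  qed
qed

section \<open>Finite Borel measures and bounded continuous functions\<close>

text \<open>The bounded continuous functions \<open>max 0 (1 - n * infdist x C)\<close> decrease to the indicator of the
  closed set \<open>C\<close>.\<close>

lemma measure_closed_eq_lim_cutoff:
  fixes M :: "'a::metric_space measure"
  assumes sM: "sets M = sets (restrict_space borel X)" and "finite_measure M"
    and C: "closed C" "C \<noteq> {}"
  shows "(\<lambda>n. integral\<^sup>L M (\<lambda>x. complex_of_real (max 0 (1 - real n * infdist x C))))
    \<longlonglongrightarrow> complex_of_real (measure M (C \<inter> X))"
proof -
  interpret finite_measure M by fact
  have sp: "space M = X" using sets_eq_imp_space_eq[OF sM] by (simp add: space_restrict_space)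
  have meas: "(\<lambda>x. f x) \<in> borel_measurable M" if "continuous_on UNIV f"
    for f :: "'a \<Rightarrow> complex"
    using borel_measurable_continuous_onI[OF that] measurable_restrict_space1
    by (subst measurable_cong_sets[OF sM refl]) blast
  have CX: "C \<inter> X \<in> sets M"
    unfolding sM sets_restrict_space using C by (auto simp: image_iff)
  have "(\<lambda>n. integral\<^sup>L M (\<lambda>x. complex_of_real (max 0 (1 - real n * infdist x C))))
    \<longlonglongrightarrow> integral\<^sup>L M (\<lambda>x. complex_of_real (indicator (C \<inter> X) x))"
  proof (rule integral_dominated_convergence[where w = "\<lambda>_. 1"])
    show "(\<lambda>x. complex_of_real (indicator (C \<inter> X) x)) \<in> borel_measurable M"
      using CX by measurable
    show "(\<lambda>x. complex_of_real (max 0 (1 - real n * infdist x C))) \<in> borel_measurable M" for n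
      by (intro meas continuous_intros)
    show "AE x in M. norm (complex_of_real (max 0 (1 - real n * infdist x C))) \<le> 1" for n
      by (simp add: infdist_nonneg)
    show "AE x in M. (\<lambda>n. complex_of_real (max 0 (1 - real n * infdist x C)))
        \<longlonglongrightarrow> complex_of_real (indicator (C \<inter> X) x)"
    proof (rule AE_I2, rule tendsto_of_real)
      fix x assume x: "x \<in> space M"
      show "(\<lambda>n. max 0 (1 - real n * infdist x C)) \<longlonglongrightarrow> indicator (C \<inter> X) x"
      proof (cases "x \<in> C")
        case True with x sp show ?thesis by simp
      next
        case False
        then have d: "infdist x C > 0" using C by (intro infdist_pos_not_in_closed)
        obtain N :: nat where N: "1 / infdist x C < N" using reals_Archimedean2 by blast
        have "max 0 (1 - real n * infdist x C) = 0" if "n \<ge> N" for n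
        proof -
          have "1 / infdist x C < n" using N that by linarith
          then show ?thesis using d by (simp add: field_simps)
        qed
        then have "eventually (\<lambda>n. max 0 (1 - real n * infdist x C) = 0) sequentially"
          by (auto simp: eventually_sequentially)
        with False show ?thesis by (simp add: tendsto_eventually)
      qed
    qed
  qed auto
  also have "integral\<^sup>L M (\<lambda>x. complex_of_real (indicator (C \<inter> X) x)) = measure M (C \<inter> X)"
    using CX sets.sets_into_space[OF CX] by (simp add: integral_complex_of_real Int_absorb2)
  finally show ?thesis .
qed

text \<open>Integrals of continuous functions determine the measures of relatively closed sets, which form an
  intersection-stable generator. This is what makes the measure described by the convolution
  functional unique.\<close>

lemma finite_measure_eqI_bounded_continuous:
  fixes M N :: "'a::metric_space measure"
  assumes X: "X \<in> sets borel"
    and sM: "sets M = sets (restrict_space borel X)" and fM: "finite_measure M"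
    and sN: "sets N = sets (restrict_space borel X)" and fN: "finite_measure N"
    and eq: "\<And>f :: 'a \<Rightarrow> complex. continuous_on X f \<Longrightarrow> bounded (f ` X) \<Longrightarrow>
      integral\<^sup>L M f = integral\<^sup>L N f"
  shows "M = N"
proof (rule measure_eqI_generator_eq[where \<Omega> = X and E = "{C \<inter> X |C. closed C}" and A = "\<lambda>_. X"])
  interpret M: finite_measure M by fact
  interpret N: finite_measure N by fact
  show "Int_stable {C \<inter> X |C. closed C}"
  proof (rule Int_stableI; safe)
    fix C D :: "'a set" assume "closed C" "closed D"
    then show "\<exists>E. C \<inter> X \<inter> (D \<inter> X) = E \<inter> X \<and> closed E"
      by (intro exI[of _ "C \<inter> D"]) auto
  qed
  have "{C \<inter> X |C. closed C} = (\<inter>) X ` Collect closed" by auto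
  then have "sigma_sets X {C \<inter> X |C. closed C} = (\<inter>) X ` sigma_sets UNIV (Collect closed)"
    using X sigma_sets_Int[of X UNIV "Collect closed"] by (simp add: borel_eq_closed)
  also have "\<dots> = sets (restrict_space borel X)"
    by (simp add: sets_restrict_space borel_eq_closed)
  finally have *: "sigma_sets X {C \<inter> X |C. closed C} = sets (restrict_space borel X)" .
  show "sets M = sigma_sets X {C \<inter> X |C. closed C}" "sets N = sigma_sets X {C \<inter> X |C. closed C}"
    using * sM sN by simp_all
  fix A assume "A \<in> {C \<inter> X |C. closed C}"
  then obtain C where A: "A = C \<inter> X" and C: "closed C" by blast
  show "emeasure M A = emeasure N A"
  proof (cases "C = {}")
    case False
    have "integral\<^sup>L M (\<lambda>x. complex_of_real (max 0 (1 - real n * infdist x C))) =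
        integral\<^sup>L N (\<lambda>x. complex_of_real (max 0 (1 - real n * infdist x C)))" for n
    proof (rule eq)
      show "bounded ((\<lambda>x. complex_of_real (max 0 (1 - real n * infdist x C))) ` X)"
        by (rule boundedI[of _ 1]) (auto simp: infdist_nonneg)
    qed (intro continuous_intros)
    with measure_closed_eq_lim_cutoff[OF sM fM C False]
    have "(\<lambda>n. integral\<^sup>L N (\<lambda>x. complex_of_real (max 0 (1 - real n * infdist x C))))
        \<longlonglongrightarrow> complex_of_real (measure M A)"
      unfolding A by (simp only:)
    with measure_closed_eq_lim_cutoff[OF sN fN C False]
    have "complex_of_real (measure N A) = complex_of_real (measure M A)"
      unfolding A by (intro LIMSEQ_unique)
    then show ?thesis by (simp add: M.emeasure_eq_measure N.emeasure_eq_measure)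
  qed (simp add: A)
qed (auto simp: finite_measure.emeasure_finite[OF fM])

section \<open>Lebesgue measure under orthogonal maps\<close>

lemma emeasure_lborel_ball_eq:
  fixes a b :: "'a::euclidean_space"
  shows "emeasure lborel (ball a r) = emeasure lborel (ball b r)"
  by (cases "r \<ge> 0") (simp_all add: emeasure_ball iffD2[OF ball_eq_empty])

text \<open>By Vitali's covering theorem an open set is, up to a null set, a disjoint union of countably many
  balls, and an orthogonal map sends balls to balls of the same radius. Only an inequality is claimed:
  then the image of the exceptional null set need not be controlled, and equality follows by applying
  the bound to the inverse map as well.\<close>

lemma emeasure_orthogonal_image_open_ge:
  fixes f :: "'a::euclidean_space \<Rightarrow> 'a"
  assumes f: "orthogonal_transformation f" and S: "open S"
  shows "emeasure lborel S \<le> emeasure lborel (f ` S)"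
proof -
  define K where "K = {i :: 'a \<times> real. ball (fst i) (snd i) \<subseteq> S}"
  let ?B = "\<lambda>i :: 'a \<times> real. ball (fst i) (snd i)"
  obtain D where D: "countable D" "D \<subseteq> K"
     "pairwise (\<lambda>i j. disjnt (?B i) (?B j)) D" "negligible (S - (\<Union>i \<in> D. ?B i))"
  proof (rule Vitali_covering_theorem_balls[of S K fst snd])
    fix x and d :: real assume "x \<in> S" "0 < d"
    then obtain e where "e > 0" "ball x e \<subseteq> S" using S openE by blast
    then show "\<exists>i. i \<in> K \<and> x \<in> ?B i \<and> snd i < d"
      using \<open>0 < d\<close> by (intro exI[of _ "(x, min e (d / 2))"]) (auto simp: K_def)
  qed
  let ?U = "\<Union>i\<in>D. ?B i"
  have inj: "inj f" using f by (rule orthogonal_transformation_inj)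
  have djB: "disjoint_family_on ?B D"
    using D(3) by (auto simp: disjoint_family_on_def pairwise_def disjnt_def)
  have djfB: "disjoint_family_on (\<lambda>i. f ` ?B i) D"
    using djB inj by (simp add: disjoint_family_on_def flip: image_Int)
  have US: "?U \<subseteq> S" using D(2) by (auto simp: K_def)
  have oU: "open ?U" by auto
  have ofS: "open (f ` S)"
    using S f by (intro open_surjective_linear_image orthogonal_transformation_linear
        orthogonal_transformation_surj)
  have "emeasure lborel (S - ?U) = 0"
    using D(4) S oU by (simp add: negligible_iff_emeasure0 emeasure_completion)
  then have "emeasure lborel S = emeasure lborel ?U"
    using US S oU emeasure_Un_null_set[of ?U lborel "S - ?U"]
    by (simp add: null_setsI Un_absorb1)
  also have "\<dots> = (\<integral>\<^sup>+i. emeasure lborel (?B i) \<partial>count_space D)"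
    by (rule emeasure_UN_countable[OF _ D(1) djB]) simp
  also have "\<dots> = (\<integral>\<^sup>+i. emeasure lborel (f ` ?B i) \<partial>count_space D)"
    by (intro nn_integral_cong) (simp add: image_orthogonal_transformation_ball[OF f] emeasure_lborel_ball_eq)
  also have "\<dots> = emeasure lborel (\<Union>i\<in>D. f ` ?B i)"
    by (rule emeasure_UN_countable[OF _ D(1) djfB, symmetric])
      (simp add: image_orthogonal_transformation_ball[OF f])
  also have "\<dots> \<le> emeasure lborel (f ` S)"
    using US ofS by (intro emeasure_mono) auto
  finally show ?thesis .
qed

lemma lborel_distr_orthogonal:
  fixes f :: "'a::euclidean_space \<Rightarrow> 'a"
  assumes f: "orthogonal_transformation f"
  shows "distr lborel borel f = lborel"
proof (rule lborel_eqI[symmetric])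
  fix l u :: 'a assume lu: "\<And>b. b \<in> Basis \<Longrightarrow> l \<bullet> b \<le> u \<bullet> b"
  have inv: "orthogonal_transformation (inv f)" by (rule orthogonal_transformation_inv[OF f])
  have bij: "bij f" using f by (rule orthogonal_transformation_bij)
  have cont: "continuous_on UNIV f"
    using f linear_continuous_on linear_linear orthogonal_transformation_linear by blast
  have vim: "f -` box l u = inv f ` box l u"
    using bij by (metis bij_vimage_eq_inv_image)
  have op: "open (f -` box l u)" using cont by (intro open_vimage) auto
  have "emeasure lborel (f -` box l u) \<le> emeasure lborel (f ` (f -` box l u))"
    by (rule emeasure_orthogonal_image_open_ge[OF f op])
  also have "f ` (f -` box l u) = box l u" using bij by (simp add: bij_is_surj)
  finally have 1: "emeasure lborel (f -` box l u) \<le> emeasure lborel (box l u)" .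
  have "emeasure lborel (box l u) \<le> emeasure lborel (f -` box l u)"
    unfolding vim by (rule emeasure_orthogonal_image_open_ge[OF inv open_box])
  with 1 have "emeasure lborel (f -` box l u) = emeasure lborel (box l u)" by simp
  then show "emeasure (distr lborel borel f) (box l u) = (\<Prod>b\<in>Basis. (u - l) \<bullet> b)"
    using lu cont
    by (simp add: emeasure_distr borel_measurable_continuous_onI emeasure_lborel_box)
qed simp

section \<open>Unitary conjugation\<close>

definition unitary_conj :: "complex^'q::finite^'q \<Rightarrow> complex^'q^'q \<Rightarrow> complex^'q^'q" where
  "unitary_conj u X = u ** X ** ctranspose u"

lemma ctranspose_unitary: "u \<in> unitary_group \<Longrightarrow> ctranspose u \<in> unitary_group"
  by (simp add: unitary_group_def)

lemma linear_unitary_conj: "linear (unitary_conj u)"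
  using linear_compose[OF matrix_linear_left matrix_linear_right]
  by (simp add: unitary_conj_def[abs_def] comp_def)

lemmas unitary_conj_simps =
  linear_add[OF linear_unitary_conj] linear_diff[OF linear_unitary_conj]
  linear_scale[OF linear_unitary_conj]

lemma unitary_conj_one: "u \<in> unitary_group \<Longrightarrow> unitary_conj u (mat 1) = mat 1"
  by (simp add: unitary_conj_def unitary_group_def)

lemma unitary_conj_mult:
  assumes "u \<in> unitary_group"
  shows "unitary_conj u X ** unitary_conj u Y = unitary_conj u (X ** Y)"
proof -
  have "unitary_conj u X ** unitary_conj u Y = u ** X ** (ctranspose u ** u) ** Y ** ctranspose u"
    by (simp add: unitary_conj_def matrix_mul_assoc)
  also have "\<dots> = u ** X ** Y ** ctranspose u" using assms by (simp add: unitary_group_def)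
  finally show ?thesis by (simp add: unitary_conj_def matrix_mul_assoc)
qed

lemma unitary_conj_ctranspose: "ctranspose (unitary_conj u X) = unitary_conj u (ctranspose X)"
  by (simp add: unitary_conj_def ctranspose_mult matrix_mul_assoc)

lemma unitary_conj_inverse:
  assumes "u \<in> unitary_group"
  shows "unitary_conj (ctranspose u) (unitary_conj u X) = X"
    "unitary_conj u (unitary_conj (ctranspose u) X) = X"
proof -
  have "unitary_conj (ctranspose u) (unitary_conj u X) = (ctranspose u ** u) ** X ** (ctranspose u ** u)"
    "unitary_conj u (unitary_conj (ctranspose u) X) = (u ** ctranspose u) ** X ** (u ** ctranspose u)"
    by (simp_all add: unitary_conj_def matrix_mul_assoc)
  with assms show "unitary_conj (ctranspose u) (unitary_conj u X) = X"
    "unitary_conj u (unitary_conj (ctranspose u) X) = X"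
    by (simp_all add: unitary_group_def)
qed

lemma trace_unitary_conj:
  assumes "u \<in> unitary_group"
  shows "trace (unitary_conj u X) = trace X"
proof -
  have "trace (unitary_conj u X) = trace (ctranspose u ** (u ** X))"
    unfolding unitary_conj_def by (rule trace_mul_sym)
  then show ?thesis using assms by (simp add: matrix_mul_assoc unitary_group_def)
qed

lemma det_unitary_conj:
  assumes "u \<in> unitary_group"
  shows "det (unitary_conj u X) = det X"
proof -
  have "det u * det (ctranspose u) = 1"
    using assms det_mul[of u "ctranspose u"] by (simp add: unitary_group_def)
  then show ?thesis by (simp add: unitary_conj_def det_mul mult_ac)
qed

lemma inner_unitary_conj_vec:
  "x \<bullet> (unitary_conj u A *v x) = (ctranspose u *v x) \<bullet> (A *v (ctranspose u *v x))"
  by (simp add: unitary_conj_def inner_mult_vec_adjoint flip: matrix_vector_mul_assoc)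

lemma pos_semidef_unitary_conj: "pos_semidef A \<Longrightarrow> pos_semidef (unitary_conj u A)"
  by (simp add: pos_semidef_iff unitary_conj_ctranspose inner_unitary_conj_vec)

lemma pos_def_unitary_conj:
  assumes "u \<in> unitary_group" "pos_def A"
  shows "pos_def (unitary_conj u A)"
proof -
  have "ctranspose u *v x \<noteq> 0" if "x \<noteq> 0" for x
  proof
    assume "ctranspose u *v x = 0"
    then have "(u ** ctranspose u) *v x = 0"
      by (simp add: matrix_vector_simps flip: matrix_vector_mul_assoc)
    with assms that show False by (simp add: unitary_group_def)
  qed
  with assms show ?thesis
    by (simp add: pos_def_iff unitary_conj_ctranspose inner_unitary_conj_vec)
qed

lemma pos_semidef_scaleR: "0 \<le> c \<Longrightarrow> pos_semidef A \<Longrightarrow> pos_semidef (c *\<^sub>R A)"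
  by (simp add: pos_semidef_iff ctranspose_simps matrix_vector_simps)

lemma one_minus_gram_unitary_conj:
  assumes "u \<in> unitary_group"
  shows "mat 1 - ctranspose (unitary_conj u w) ** unitary_conj u w =
    unitary_conj u (mat 1 - ctranspose w ** w)"
  using assms
  by (simp add: unitary_conj_ctranspose unitary_conj_mult unitary_conj_simps unitary_conj_one)

lemma matrix_ball_unitary_conj:
  assumes u: "u \<in> unitary_group"
  shows "unitary_conj u w \<in> matrix_ball \<longleftrightarrow> w \<in> matrix_ball"
proof -
  have *: "unitary_conj v z \<in> matrix_ball" if "v \<in> unitary_group" "z \<in> matrix_ball" for v z
    using that by (simp add: matrix_ball_def one_minus_gram_unitary_conj pos_def_unitary_conj)
  show ?thesis
    using *[OF u, of w] *[OF ctranspose_unitary[OF u], of "unitary_conj u w"]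
    by (auto simp: unitary_conj_inverse u)
qed

lemma ball_weight_unitary_conj:
  "u \<in> unitary_group \<Longrightarrow> ball_weight p (unitary_conj u w) = ball_weight p w"
  by (simp add: ball_weight_def one_minus_gram_unitary_conj det_unitary_conj)

text \<open>Unitarity of \<open>u\<close> says that \<open>unitary_conj (ctranspose u)\<close> is the inverse of \<open>unitary_conj u\<close>; it is
  also the adjoint for the Frobenius product.\<close>

lemma orthogonal_unitary_conj:
  fixes u :: "complex^'q::finite^'q"
  assumes "u \<in> unitary_group"
  shows "orthogonal_transformation (unitary_conj u)"
  unfolding orthogonal_transformation_def
proof (intro conjI allI linear_unitary_conj)
  fix v w :: "complex^'q^'q"
  have "unitary_conj u v \<bullet> unitary_conj u w =
      v \<bullet> (ctranspose u ** (unitary_conj u w ** ctranspose (ctranspose u)))"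
    unfolding unitary_conj_def[of u v] inner_mult_right_adjoint[of "u ** v"]
    by (rule inner_mult_left_adjoint)
  then have "unitary_conj u v \<bullet> unitary_conj u w =
      v \<bullet> unitary_conj (ctranspose u) (unitary_conj u w)"
    by (simp add: unitary_conj_def[of "ctranspose u"] matrix_mul_assoc)
  then show "unitary_conj u v \<bullet> unitary_conj u w = v \<bullet> w"
    using assms by (simp add: unitary_conj_inverse)
qed

section \<open>The points occurring in a convolution\<close>

lemma norm_matrix_ball_le:
  assumes "w \<in> matrix_ball" shows "norm (w *v y) \<le> norm y"
proof -
  have "0 \<le> y \<bullet> ((mat 1 - ctranspose w ** w) *v y)"
    using assms pos_def_imp_pos_semidef[of "mat 1 - ctranspose w ** w"]
    by (simp add: matrix_ball_def pos_semidef_iff)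
  also have "\<dots> = y \<bullet> y - (w *v y) \<bullet> (w *v y)"
    by (simp add: matrix_vector_simps inner_diff_right inner_mult_vec_adjoint
        flip: matrix_vector_mul_assoc)
  finally show ?thesis by (simp add: norm_le)
qed

definition sqrt_argument :: "complex^'q::finite^'q \<Rightarrow> complex^'q^'q \<Rightarrow> complex^'q^'q \<Rightarrow> complex^'q^'q"
  where "sqrt_argument r s w = r ** r + s ** s + r ** w ** s + ctranspose (r ** w ** s)"

text \<open>With \<open>y = r x\<close> and \<open>z = s x\<close> the quadratic form at \<open>x\<close> is
  \<open>(norm y)\<^sup>2 + (norm z)\<^sup>2 + 2 * (y \<bullet> w z)\<close>, which is at least \<open>(norm (y + w z))\<^sup>2\<close> because \<open>w\<close> is a contraction.\<close>

lemma sqrt_argument_in_cone: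
  fixes r s w :: "complex^'q::finite^'q"
  assumes r: "r \<in> psd_cone" and s: "s \<in> psd_cone" and w: "w \<in> matrix_ball"
  shows "sqrt_argument r s w \<in> psd_cone"
proof -
  have rs: "ctranspose r = r" "ctranspose s = s"
    using r s by (simp_all add: psd_cone_def pos_semidef_iff)
  have "0 \<le> x \<bullet> (sqrt_argument r s w *v x)" for x
  proof -
    define y z where "y = r *v x" and "z = s *v x"
    have 1: "x \<bullet> ((r ** w ** s) *v x) = y \<bullet> (w *v z)"
      by (simp add: y_def z_def inner_mult_vec_adjoint rs flip: matrix_vector_mul_assoc)
    have "x \<bullet> (ctranspose (r ** w ** s) *v x) = y \<bullet> (w *v z)"
      by (simp add: 1 inner_commute flip: inner_mult_vec_adjoint)
    then have "x \<bullet> (sqrt_argument r s w *v x) = (norm y)\<^sup>2 + (norm z)\<^sup>2 + 2 * (y \<bullet> (w *v z))"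
      using 1 by (simp add: sqrt_argument_def matrix_vector_simps inner_add_right inner_square rs
          y_def z_def)
    moreover have "(norm (w *v z))\<^sup>2 \<le> (norm z)\<^sup>2"
      using norm_matrix_ball_le[OF w] by (simp add: power_mono)
    moreover have "0 \<le> (norm (y + w *v z))\<^sup>2" by simp
    then have "0 \<le> (norm y)\<^sup>2 + (norm (w *v z))\<^sup>2 + 2 * (y \<bullet> (w *v z))"
      by (simp add: power2_norm_eq_inner inner_simps inner_commute)
    ultimately show ?thesis by linarith
  qed
  then show ?thesis
    by (simp add: psd_cone_def pos_semidef_iff sqrt_argument_def ctranspose_simps ctranspose_mult rs
        matrix_mul_assoc add_ac)
qed

lemma conv_point_eq:
  "conv_point x y w = (psd_sqrt (sqrt_argument (fst x) (fst y) w),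
    snd x + snd y - Im (trace (fst x ** w ** fst y)))"
  by (cases x; cases y) (simp add: sqrt_argument_def)

lemma conv_point_in_hg_space:
  assumes "x \<in> hg_space" "y \<in> hg_space" "w \<in> matrix_ball"
  shows "conv_point x y w \<in> hg_space"
  using assms sqrt_argument_in_cone[of "fst x" "fst y" w]
  by (auto simp: conv_point_eq hg_space_def psd_sqrt_in_cone_square)

lemma continuous_on_conv_point:
  assumes "x \<in> hg_space" "y \<in> hg_space"
  shows "continuous_on matrix_ball (conv_point x y)"
proof -
  have "continuous_on matrix_ball (\<lambda>w. psd_sqrt (sqrt_argument (fst x) (fst y) w))"
  proof (rule continuous_on_compose2[OF continuous_on_psd_sqrt])
    show "continuous_on matrix_ball (sqrt_argument (fst x) (fst y))"
      unfolding sqrt_argument_def by (intro continuous_intros)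
    show "sqrt_argument (fst x) (fst y) ` matrix_ball \<subseteq> psd_cone"
      using assms sqrt_argument_in_cone by (auto simp: hg_space_def)
  qed
  moreover have "continuous_on matrix_ball (\<lambda>w. snd x + snd y - Im (trace (fst x ** w ** fst y)))"
    unfolding trace_def by (intro continuous_intros)
  ultimately show ?thesis
    unfolding conv_point_eq[abs_def] by (rule continuous_on_Pair)
qed

lemma T_map_eq: "T_map u l x = (l *\<^sub>R unitary_conj u (fst x), l\<^sup>2 * snd x)"
  by (cases x) (simp add: T_map_def unitary_conj_def)

lemma psd_sqrt_scale_unitary_conj:
  assumes u: "u \<in> unitary_group" and l: "0 \<le> l" and A: "A \<in> psd_cone"
  shows "psd_sqrt (l\<^sup>2 *\<^sub>R unitary_conj u A) = l *\<^sub>R unitary_conj u (psd_sqrt A)"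
proof (rule psd_sqrt_unique)
  note S = psd_sqrt_in_cone_square[OF A]
  show "l *\<^sub>R unitary_conj u (psd_sqrt A) \<in> psd_cone"
    using S(1) l by (simp add: psd_cone_def pos_semidef_scaleR pos_semidef_unitary_conj)
  show "(l *\<^sub>R unitary_conj u (psd_sqrt A)) ** (l *\<^sub>R unitary_conj u (psd_sqrt A)) =
      l\<^sup>2 *\<^sub>R unitary_conj u A"
    using u S(2) by (simp add: matrix_ring_simps unitary_conj_mult power2_eq_square)
qed

text \<open>Conjugating \<open>r\<close>, \<open>s\<close> and \<open>w\<close> simultaneously conjugates every product of them. The argument of the
  square root and the trace term are both homogeneous of degree two in \<open>(r, s)\<close>, which is why the
  real coordinate has to be scaled by \<open>l\<^sup>2\<close> when the matrix coordinate is scaled by \<open>l\<close>.\<close>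

lemma conv_point_T_map:
  assumes u: "u \<in> unitary_group" and l: "0 \<le> l"
    and x: "x \<in> hg_space" and y: "y \<in> hg_space" and w: "w \<in> matrix_ball"
  shows "conv_point (T_map u l x) (T_map u l y) (unitary_conj u w) = T_map u l (conv_point x y w)"
proof -
  define r s where "r = fst x" and "s = fst y"
  have prod: "(l *\<^sub>R unitary_conj u r) ** unitary_conj u w ** (l *\<^sub>R unitary_conj u s) =
      l\<^sup>2 *\<^sub>R unitary_conj u (r ** w ** s)"
    using u by (simp add: matrix_ring_simps unitary_conj_mult power2_eq_square)
  have "sqrt_argument (l *\<^sub>R unitary_conj u r) (l *\<^sub>R unitary_conj u s) (unitary_conj u w) =
      l\<^sup>2 *\<^sub>R unitary_conj u (sqrt_argument r s w)"
    unfolding sqrt_argument_def prod using u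
    by (simp add: matrix_ring_simps unitary_conj_mult unitary_conj_simps ctranspose_simps
        unitary_conj_ctranspose power2_eq_square scaleR_add_right)
  moreover have "sqrt_argument r s w \<in> psd_cone"
    using x y w by (intro sqrt_argument_in_cone) (auto simp: hg_space_def r_def s_def)
  moreover have "trace (l\<^sup>2 *\<^sub>R unitary_conj u (r ** w ** s)) = l\<^sup>2 *\<^sub>R trace (r ** w ** s)"
    using trace_unitary_conj[OF u, of "r ** w ** s"] by (simp add: trace_def flip: scaleR_sum_right)
  ultimately show ?thesis
    using psd_sqrt_scale_unitary_conj[OF u l]
    by (simp add: conv_point_eq T_map_eq prod algebra_simps flip: r_def s_def)
qed

section \<open>The mapping as a homeomorphism\<close>

lemma T_map_in_hg_space: "0 \<le> l \<Longrightarrow> x \<in> hg_space \<Longrightarrow> T_map u l x \<in> hg_space"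
  by (auto simp: T_map_eq hg_space_def psd_cone_def pos_semidef_scaleR pos_semidef_unitary_conj)

lemma continuous_on_T_map: "continuous_on S (T_map u l)"
  unfolding T_map_eq[abs_def] unitary_conj_def by (intro continuous_intros)

lemma T_map_inverse:
  assumes "u \<in> unitary_group" "l \<noteq> 0"
  shows "T_map (ctranspose u) (inverse l) (T_map u l x) = x"
    "T_map u l (T_map (ctranspose u) (inverse l) x) = x"
  using assms
  by (simp_all add: T_map_eq unitary_conj_simps unitary_conj_inverse power_inverse prod_eq_iff)

lemma homeomorphism_T_map:
  assumes u: "u \<in> unitary_group" and l: "0 < l"
  shows "homeomorphism hg_space hg_space (T_map u l) (T_map (ctranspose u) (inverse l))"
  using l
  by (intro homeomorphismI continuous_on_T_map)
    (simp_all add: image_subset_iff T_map_in_hg_space T_map_inverse[OF u])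

lemma T_map_involution: "T_map u l (hg_involution y) = hg_involution (T_map u l y)"
  by (cases y) (simp add: T_map_eq hg_involution_def)

section \<open>Convolution of point measures\<close>

lemma matrix_ball_borel [measurable]: "(matrix_ball :: (complex^'q::finite^'q) set) \<in> sets borel"
proof -
  have "matrix_ball = (\<lambda>w. mat 1 - ctranspose w ** w) -`
      {A :: complex^'q^'q. \<forall>x. x \<noteq> 0 \<longrightarrow> 0 < x \<bullet> (A *v x)}"
    by (auto simp: matrix_ball_def pos_def_iff ctranspose_simps ctranspose_mult)
  also have "open \<dots>"
    by (intro open_vimage open_positive_forms continuous_intros)
  finally show ?thesis by simp
qed

lemma ball_weight_measurable [measurable]:
  "ball_weight p \<in> borel_measurable (borel :: (complex^'q::finite^'q) measure)"
proof -
  have "continuous_on UNIV (\<lambda>w :: complex^'q^'q. Re (det (mat 1 - ctranspose w ** w)))"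
    unfolding det_def by (intro continuous_intros)
  then have [measurable]: "(\<lambda>w :: complex^'q^'q. Re (det (mat 1 - ctranspose w ** w)))
      \<in> borel_measurable borel"
    by (rule borel_measurable_continuous_onI)
  show ?thesis unfolding ball_weight_def[abs_def] by measurable
qed

text \<open>Substitute \<open>unitary_conj u w\<close> for \<open>w\<close>: this preserves Lebesgue measure, the ball and the weight, and
  moves \<open>T_map\<close> out of the convolution points.\<close>

lemma conv_functional_T_map:
  fixes u :: "complex^'q::finite^'q" and f :: "(complex^'q^'q) \<times> real \<Rightarrow> complex"
  assumes u: "u \<in> unitary_group" and l: "0 \<le> l"
    and x: "x \<in> hg_space" and y: "y \<in> hg_space" and f: "continuous_on hg_space f"
  shows "conv_functional p (T_map u l x) (T_map u l y) f =
    conv_functional p x y (\<lambda>z. f (T_map u l z))"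
proof -
  let ?x = "T_map u l x" and ?y = "T_map u l y"
  have xy: "?x \<in> hg_space" "?y \<in> hg_space" using T_map_in_hg_space l x y by blast+
  let ?g = "\<lambda>w. indicator matrix_ball w *\<^sub>R (ball_weight p w *\<^sub>R f (conv_point ?x ?y w))"
  have "continuous_on matrix_ball (\<lambda>w. f (conv_point ?x ?y w))"
    by (rule continuous_on_compose2[OF f continuous_on_conv_point[OF xy]])
      (use conv_point_in_hg_space[OF xy] in blast)
  then have [measurable]: "(\<lambda>w. indicator matrix_ball w *\<^sub>R f (conv_point ?x ?y w))
      \<in> borel_measurable borel"
    by (rule borel_measurable_continuous_on_indicator[OF matrix_ball_borel])
  have "(\<lambda>w. ball_weight p w *\<^sub>R (indicator matrix_ball w *\<^sub>R f (conv_point ?x ?y w)))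
      \<in> borel_measurable borel" by measurable
  then have g: "?g \<in> borel_measurable borel" by (simp add: mult.commute)
  have U: "unitary_conj u \<in> borel_measurable borel"
    by (intro borel_measurable_continuous_onI linear_continuous_on)
      (use linear_unitary_conj linear_linear in blast)
  have "(LINT w:matrix_ball|lborel. ball_weight p w *\<^sub>R f (conv_point ?x ?y w)) =
      integral\<^sup>L (distr lborel borel (unitary_conj u)) ?g"
    by (simp add: set_lebesgue_integral_def lborel_distr_orthogonal[OF orthogonal_unitary_conj[OF u]])
  also have "\<dots> = integral\<^sup>L lborel (\<lambda>w. ?g (unitary_conj u w))"
    using U g by (intro integral_distr) simp_all
  also have "\<dots> = (LINT w:matrix_ball|lborel. ball_weight p w *\<^sub>R f (T_map u l (conv_point x y w)))"
    unfolding set_lebesgue_integral_def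
    by (rule Bochner_Integration.integral_cong)
      (auto simp: indicator_def matrix_ball_unitary_conj[OF u] ball_weight_unitary_conj[OF u]
        conv_point_T_map[OF u l x y])
  finally show ?thesis by (simp add: conv_functional_def)
qed

text \<open>The characterising property under the definite description in \<open>point_conv\<close>, so that its existence
  and uniqueness can be stated.\<close>

definition is_point_conv ::
  "real \<Rightarrow> (complex^'q::finite^'q) \<times> real \<Rightarrow> (complex^'q^'q) \<times> real
    \<Rightarrow> ((complex^'q^'q) \<times> real) measure \<Rightarrow> bool" where
  "is_point_conv p x y M \<longleftrightarrow>
     sets M = sets (restrict_space borel hg_space) \<and> finite_measure M \<and>
        (\<forall>f :: (complex^'q^'q) \<times> real \<Rightarrow> complex.
           continuous_on hg_space f \<and> bounded (f ` hg_space) \<longrightarrow>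
           integral\<^sup>L M f = conv_functional p x y f)"

lemma hg_space_borel: "hg_space \<in> sets borel"
  unfolding hg_space_def by (intro borel_closed closed_Times closed_psd_cone closed_UNIV)

lemma is_point_conv_unique: "is_point_conv p x y M \<Longrightarrow> is_point_conv p x y N \<Longrightarrow> M = N"
  unfolding is_point_conv_def
  by (rule finite_measure_eqI_bounded_continuous[OF hg_space_borel]) auto

text \<open>The measure is the image of the weighted Lebesgue measure on the ball under \<open>conv_point x y\<close>, which
  is measurable because the square root is continuous.\<close>

lemma is_point_conv_exists:
  fixes x y :: "(complex^'q::finite^'q) \<times> real"
  assumes x: "x \<in> hg_space" and y: "y \<in> hg_space"
  shows "\<exists>M. is_point_conv p x y M"
proof -
  define k where "k = kappa TYPE('q) p"
  define R where "R = restrict_space lborel (matrix_ball :: (complex^'q^'q) set)"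
  define D where "D = density R (\<lambda>w. ennreal (k * ball_weight p w))"
  define M where "M = distr D (restrict_space borel hg_space) (conv_point x y)"
  have int: "(LINT w:(matrix_ball :: (complex^'q^'q) set)|lborel. ball_weight p w) = integral\<^sup>L R (ball_weight p)"
    by (simp add: R_def integral_restrict_space set_lebesgue_integral_def)
  have wt: "0 \<le> ball_weight p w" for w :: "complex^'q^'q" by (simp add: ball_weight_def)
  have k: "0 \<le> k" by (simp add: k_def kappa_def int wt integral_nonneg)
  have [measurable]: "ball_weight p \<in> borel_measurable R"
    unfolding R_def by (rule measurable_restrict_space1) simp
  have "conv_point x y \<in> borel_measurable R"
    using borel_measurable_continuous_on_restrict[OF continuous_on_conv_point[OF x y]]
    by (simp add: R_def cong: measurable_cong_sets sets_restrict_space_cong)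
  then have cp: "conv_point x y \<in> measurable R (restrict_space borel hg_space)"
    by (rule measurable_restrict_space2[rotated])
      (auto simp: R_def space_restrict_space intro: conv_point_in_hg_space x y)
  have "(\<integral>\<^sup>+w. ennreal (k * ball_weight p w) \<partial>R) < \<infinity>"
  proof (cases "integrable R (ball_weight p)")
    case True
    then have "integrable R (\<lambda>w. k * ball_weight p w)" by simp
    then have "(\<integral>\<^sup>+w. ennreal (norm (k * ball_weight p w)) \<partial>R) < \<infinity>"
      by (simp only: integrable_iff_bounded)
    then show ?thesis using k wt by simp
  next
    case False
    \<comment> \<open>The Bochner integral of a non-integrable function is 0, and so is the inverse of 0: the
    normalised density vanishes, and with it the convolution functional.\<close>
    then have "k = 0" by (simp add: k_def kappa_def int not_integrable_integral_eq)
    then show ?thesis by simp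
  qed
  then have fD: "finite_measure D"
    by (intro finite_measureI) (simp add: D_def emeasure_density cong: nn_integral_cong)
  have "integral\<^sup>L M f = conv_functional p x y f" if f: "continuous_on hg_space f"
    for f :: "(complex^'q^'q) \<times> real \<Rightarrow> complex"
  proof -
    note f' = borel_measurable_continuous_on_restrict[OF f]
    have "integral\<^sup>L M f = integral\<^sup>L D (\<lambda>w. f (conv_point x y w))"
      unfolding M_def using cp f' by (intro integral_distr) (simp_all add: D_def)
    also have "\<dots> = integral\<^sup>L R (\<lambda>w. (k * ball_weight p w) *\<^sub>R f (conv_point x y w))"
      unfolding D_def using k wt measurable_compose[OF cp f'] by (intro integral_density) auto
    also have "\<dots> = k *\<^sub>R integral\<^sup>L R (\<lambda>w. ball_weight p w *\<^sub>R f (conv_point x y w))"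
      by (simp flip: scaleR_scaleR)
    finally show ?thesis
      by (simp add: conv_functional_def R_def k_def integral_restrict_space set_lebesgue_integral_def)
  qed
  moreover have "finite_measure M"
    unfolding M_def using cp by (intro finite_measure.finite_measure_distr fD) (simp add: D_def)
  ultimately have "is_point_conv p x y M" by (simp add: is_point_conv_def M_def)
  then show ?thesis ..
qed

lemma point_conv_eqI:
  assumes "is_point_conv p x y M"
  shows "point_conv p x y = M"
  unfolding point_conv_def is_point_conv_def[symmetric]
  using assms is_point_conv_unique by (intro the_equality)

lemma is_point_conv_T_map:
  assumes u: "u \<in> unitary_group" and l: "0 \<le> l"
    and x: "x \<in> hg_space" and y: "y \<in> hg_space" and M: "is_point_conv p x y M"
  shows "is_point_conv p (T_map u l x) (T_map u l y)
    (distr M (restrict_space borel hg_space) (T_map u l))"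
proof -
  let ?B = "restrict_space borel hg_space"
  have sM: "sets M = sets ?B" and fM: "finite_measure M" using M by (auto simp: is_point_conv_def)
  have "T_map u l \<in> measurable ?B ?B"
    by (intro measurable_restrict_space3 borel_measurable_continuous_onI continuous_on_T_map)
      (use l T_map_in_hg_space in auto)
  then have T: "T_map u l \<in> measurable M ?B" using sM by (simp cong: measurable_cong_sets)
  have "integral\<^sup>L (distr M ?B (T_map u l)) f = conv_functional p (T_map u l x) (T_map u l y) f"
    if f: "continuous_on hg_space f" and b: "bounded (f ` hg_space)" for f :: "_ \<Rightarrow> complex"
  proof -
    have "integral\<^sup>L (distr M ?B (T_map u l)) f = integral\<^sup>L M (\<lambda>z. f (T_map u l z))"
      by (rule integral_distr[OF T borel_measurable_continuous_on_restrict[OF f]])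
    also have "\<dots> = conv_functional p x y (\<lambda>z. f (T_map u l z))"
    proof -
      have sub: "T_map u l ` hg_space \<subseteq> hg_space" using T_map_in_hg_space[OF l] by auto
      have "continuous_on hg_space (\<lambda>z. f (T_map u l z))"
        by (rule continuous_on_compose2[OF f continuous_on_T_map sub])
      moreover have "bounded ((\<lambda>z. f (T_map u l z)) ` hg_space)"
        by (rule bounded_subset[OF b]) (use sub in auto)
      ultimately show ?thesis using M by (simp add: is_point_conv_def)
    qed
    also have "\<dots> = conv_functional p (T_map u l x) (T_map u l y) f"
      using conv_functional_T_map[OF u l x y f] by simp
    finally show ?thesis .
  qed
  then show ?thesis
    by (simp add: is_point_conv_def finite_measure.finite_measure_distr[OF fM T])
qed

theorem lemma2p6:
  fixes p l :: real and u :: "complex^'q::finite^'q"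
  assumes "p > 2 * real CARD('q) - 1"
    and "u \<in> unitary_group"
    and "l > 0"
  shows "hypergroup_automorphism hg_space (point_conv p) hg_involution (T_map u l)"
  unfolding hypergroup_automorphism_def
proof (intro conjI ballI)
  show "\<exists>T'. homeomorphism hg_space hg_space (T_map u l) T'"
    using homeomorphism_T_map assms by blast
next
  fix x y :: "(complex^'q^'q) \<times> real"
  assume x: "x \<in> hg_space" and "y \<in> hg_space"
  then have y: "hg_involution y \<in> hg_space" by (auto simp: hg_space_def hg_involution_def)
  obtain M where M: "is_point_conv p x (hg_involution y) M"
    using is_point_conv_exists[OF x y] ..
  have "is_point_conv p (T_map u l x) (hg_involution (T_map u l y))
      (distr M (restrict_space borel hg_space) (T_map u l))"
    using is_point_conv_T_map[OF assms(2) _ x y M] assms(3) by (simp add: T_map_involution)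
  then show "distr (point_conv p x (hg_involution y)) (restrict_space borel hg_space) (T_map u l) =
      point_conv p (T_map u l x) (hg_involution (T_map u l y))"
    using point_conv_eqI M by metis
qed

end
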